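(* Let $K$ be a field, let $n\ge 1$ and $k\ge 1$ be integers, let $S=K[x_1,\ldots,x_n]$, and let $\mathbf m=(x_1,\ldots,x_n)\subset S$. Then $$\operatorname{sdepth}(\mathbf m^k)\le\left\lceil\frac{n}{k+1}\right\rceil .$$ In particular, if $k\ge n-1$, then $\operatorname{sdepth}(\mathbf m^k)=1$.
   Context: $S$ carries its standard $\mathbb Z^n$-grading, in which $x_i$ has degree the $i$-th standard basis vector of $\mathbb Z^n$; monomial ideals are $\mathbb Z^n$-graded $S$-modules. A Stanley decomposition of a nonzero finitely generated $\mathbb Z^n$-graded $S$-module $M$ is a finite direct sum decomposition $\mathcal D:\ M=\bigoplus_{i=1}^r m_iK[Z_i]$ as a $K$-vector space, where each $m_i\in M$ is homogeneous, $Z_i\subset\{x_1,\ldots,x_n\}$ is a subset (possibly empty), $m_iK[Z_i]$ is the $K[Z_i]$-submodule of $M$ generated by $m_i$, and $m_iK[Z_i]$ is a free $K[Z_i]$-module of rank one (i.e. $m_i$ is not annihilated by any nonzero element of $K[Z_i]$). Put $\operatorname{sdepth}(\mathcal D)=\min_{1\le i\le r}|Z_i|$. The Stanley depth of $M$ is $\operatorname{sdepth}(M)=\max\{\operatorname{sdepth}(\mathcal D)\}$, the maximum over all Stanley decompositions $\mathcal D$ of $M$. *)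

theory Defs
  imports "HOL-Library.Poly_Mapping" "HOL-Analysis.Finite_Cartesian_Product"
begin

text \<open>
  The polynomial ring \<open>S = K[x\<^sub>1, \<dots>, x\<^sub>n]\<close>: the variables are indexed by a finite type \<open>'n\<close> with
  \<open>n = CARD('n)\<close>, so \<open>n \<ge> 1\<close> is automatic; monomials are exponent vectors \<open>'n \<Rightarrow>\<^sub>0 nat\<close>, and the
  library multiplication on \<open>\<Rightarrow>\<^sub>0\<close> is that of the monoid algebra.
\<close>

type_synonym ('n, 'k) mpoly = "('n \<Rightarrow>\<^sub>0 nat) \<Rightarrow>\<^sub>0 'k"

definition mvar :: "'n \<Rightarrow> ('n, 'k::field) mpoly"
  where "mvar i = Poly_Mapping.single (Poly_Mapping.single i 1) 1"

definition subalgebra :: "'n set \<Rightarrow> ('n, 'k::field) mpoly set"  \<comment> \<open>\<open>K[Z]\<close>\<close>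
  where "subalgebra Z = {p. \<forall>u\<in>Poly_Mapping.keys p. Poly_Mapping.keys u \<subseteq> Z}"

definition monomial_degree :: "('n::finite \<Rightarrow>\<^sub>0 nat) \<Rightarrow> int ^ 'n"
  where "monomial_degree u = (\<chi> i. int (Poly_Mapping.lookup u i))"

definition mpoly_part :: "int ^ 'n \<Rightarrow> ('n::finite, 'k::field) mpoly set"  \<comment> \<open>\<open>S\<^sub>a\<close>\<close>
  where "mpoly_part a = {p. \<forall>u\<in>Poly_Mapping.keys p. monomial_degree u = a}"

text \<open>
  Nonzero finitely generated multigraded modules.  The module is a submodule \<open>M\<close> of an ambient
  module, so that ideals are covered by the ambient module \<open>S\<close>; \<open>part a\<close> is its component of
  degree \<open>a\<close>.  Closure of \<open>part a\<close> under scalars from \<open>K\<close> is the case \<open>b = 0\<close> of \<open>scale_part\<close>.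
\<close>

locale multigraded_module = module scale
  for scale :: "('n::finite, 'k::field) mpoly \<Rightarrow> 'm::ab_group_add \<Rightarrow> 'm" (infixr "\<cdot>" 75) +
  fixes M :: "'m set" and part :: "int ^ 'n \<Rightarrow> 'm set"
  assumes submodule: "subspace M"
    and finitely_generated: "\<exists>B. finite B \<and> M = span B"
    and nonzero: "M \<noteq> {0}"
    and part_subset: "part a \<subseteq> M"
    and zero_part: "0 \<in> part a"
    and add_part: "x \<in> part a \<Longrightarrow> y \<in> part a \<Longrightarrow> x + y \<in> part a"
    and scale_part: "p \<in> mpoly_part b \<Longrightarrow> x \<in> part a \<Longrightarrow> p \<cdot> x \<in> part (b + a)"
    and part_direct_sum: "x \<in> M \<Longrightarrow>
      \<exists>!c. (\<forall>a. c a \<in> part a) \<and> finite {a. c a \<noteq> 0} \<and> x = (\<Sum>a | c a \<noteq> 0. c a)"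
begin

definition homogeneous :: "'m \<Rightarrow> bool"
  where "homogeneous m \<longleftrightarrow> (\<exists>a. m \<in> part a)"

definition stanley_space :: "'m \<Rightarrow> 'n set \<Rightarrow> 'm set"  \<comment> \<open>\<open>m K[Z]\<close>\<close>
  where "stanley_space m Z = {p \<cdot> m | p. p \<in> subalgebra Z}"

definition stanley_decomposition :: "('m \<times> 'n set) list \<Rightarrow> bool"
  where "stanley_decomposition D \<longleftrightarrow>
    (\<forall>(m, Z) \<in> set D. m \<in> M \<and> homogeneous m \<and> (\<forall>p\<in>subalgebra Z. p \<noteq> 0 \<longrightarrow> p \<cdot> m \<noteq> 0)) \<and>
    (\<forall>x\<in>M. \<exists>!vs. list_all2 (\<lambda>v (m, Z). v \<in> stanley_space m Z) vs D \<and> x = sum_list vs)"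

text \<open>A decomposition of the nonzero module \<open>M\<close> has at least one summand, so the minimum is over a
  nonempty set.\<close>

definition decomposition_sdepth :: "('m \<times> 'n set) list \<Rightarrow> nat"
  where "decomposition_sdepth D = Min ((\<lambda>(m, Z). card Z) ` set D)"

definition sdepth :: nat
  where "sdepth = Max {decomposition_sdepth D | D. stanley_decomposition D}"

end

text \<open>In the library, \<^term>\<open>module.span (*) A\<close> is the span of \<open>A\<close> in the ring as a module over
  itself, i.e. the ideal generated by \<open>A\<close>.\<close>

definition ideal_gen :: "'a::comm_ring_1 set \<Rightarrow> 'a set"
  where "ideal_gen A = module.span (*) A"

primrec ideal_power :: "'a::comm_ring_1 set \<Rightarrow> nat \<Rightarrow> 'a set"
  where
    "ideal_power I 0 = UNIV"
  | "ideal_power I (Suc k) = ideal_gen {a * b | a b. a \<in> I \<and> b \<in> ideal_power I k}"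

definition max_ideal :: "('n, 'k::field) mpoly set"
  where "max_ideal = ideal_gen (range mvar)"

definition ideal_part :: "('n::finite, 'k::field) mpoly set \<Rightarrow> int ^ 'n \<Rightarrow> ('n, 'k) mpoly set"
  where "ideal_part I a = I \<inter> mpoly_part a"

definition ideal_sdepth :: "('n::finite, 'k::field) mpoly set \<Rightarrow> nat"
  where "ideal_sdepth I = multigraded_module.sdepth (*) I (ideal_part I)"

text \<open>The powers of the maximal ideal satisfy the assumptions of the locale.\<close>

lemma module_mult: "module ((*) :: 'a::comm_ring_1 \<Rightarrow> 'a \<Rightarrow> 'a)"
  by standard (auto simp: algebra_simps)

(* a local interpretation: its simp rule scale_scale loops with mult.assoc *)
context
begin

interpretation ring_module: module "(*) :: 'a::comm_ring_1 \<Rightarrow> 'a \<Rightarrow> 'a"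
  by (rule module_mult)

lemma monomials_in_ideal_gen:
  fixes B :: "('n, 'k::field) mpoly set"
  assumes "\<And>b u. b \<in> B \<Longrightarrow> u \<in> Poly_Mapping.keys b \<Longrightarrow> Poly_Mapping.single u 1 \<in> ideal_gen B"
    and "p \<in> ideal_gen B" and "u \<in> Poly_Mapping.keys p"
  shows "Poly_Mapping.single u 1 \<in> ideal_gen B"
  using assms(2,3) unfolding ideal_gen_def
proof (induction arbitrary: u rule: ring_module.span_induct_alt)
  case base
  then show ?case by simp
next
  case (step c b y)
  from step.prems keys_add[of "c * b" y]
  consider "u \<in> Poly_Mapping.keys (c * b)" | "u \<in> Poly_Mapping.keys y" by auto
  then show ?case
  proof cases
    case 1
    then obtain s t where u: "u = s + t" and t: "t \<in> Poly_Mapping.keys b"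
      using keys_mult[of c b] by blast
    have "Poly_Mapping.single u (1::'k) = Poly_Mapping.single s 1 * Poly_Mapping.single t 1"
      by (simp add: u mult_single)
    then show ?thesis
      using assms(1)[OF step.hyps(1) t] by (simp add: ideal_gen_def ring_module.span_scale)
  next
    case 2
    then show ?thesis by (rule step.IH)
  qed
qed

lemma monomials_in_max_ideal:
  fixes p :: "('n, 'k::field) mpoly"
  assumes "p \<in> max_ideal" and "u \<in> Poly_Mapping.keys p"
  shows "Poly_Mapping.single u 1 \<in> (max_ideal :: ('n, 'k) mpoly set)"
  using assms unfolding max_ideal_def
  by (rule monomials_in_ideal_gen[rotated])
    (auto simp: mvar_def ideal_gen_def intro!: ring_module.span_base)

lemma monomials_in_max_ideal_power:
  fixes p :: "('n, 'k::field) mpoly"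
  assumes "p \<in> ideal_power max_ideal k" and "u \<in> Poly_Mapping.keys p"
  shows "Poly_Mapping.single u 1 \<in> (ideal_power max_ideal k :: ('n, 'k) mpoly set)"
  using assms
proof (induction k arbitrary: p u)
  case 0
  then show ?case by simp
next
  case (Suc k)
  let ?B = "{a * b | a b. a \<in> (max_ideal :: ('n, 'k) mpoly set) \<and> b \<in> ideal_power max_ideal k}"
  have "Poly_Mapping.single v 1 \<in> ideal_gen ?B" if "b \<in> ?B" "v \<in> Poly_Mapping.keys b" for b v
  proof -
    from that obtain x y where b: "b = x * y" "x \<in> max_ideal" "y \<in> ideal_power max_ideal k"
      by blast
    have "v \<in> Poly_Mapping.keys (x * y)" using that(2) b(1) by simp
    with keys_mult[of x y] obtain s t where v: "v = s + t"
      and "s \<in> Poly_Mapping.keys x" "t \<in> Poly_Mapping.keys y" by blast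
    then have "Poly_Mapping.single s 1 \<in> (max_ideal :: ('n, 'k) mpoly set)"
      "Poly_Mapping.single t 1 \<in> (ideal_power max_ideal k :: ('n, 'k) mpoly set)"
      using b monomials_in_max_ideal Suc.IH by blast+
    moreover have "Poly_Mapping.single v (1::'k) = Poly_Mapping.single s 1 * Poly_Mapping.single t 1"
      by (simp add: v mult_single)
    ultimately show ?thesis
      unfolding ideal_gen_def by (intro ring_module.span_base) blast
  qed
  then show ?case
    using monomials_in_ideal_gen[of ?B p u] Suc.prems by auto
qed

lemma subspace_ideal_power:
  "ring_module.subspace (ideal_power I k)"
  by (cases k) (simp_all add: ideal_gen_def)

lemma finitely_generated_ideal_power:
  assumes "finite A"
  shows "\<exists>B. finite B \<and> ideal_power (ideal_gen A) k = ring_module.span B"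
proof (induction k)
  case 0
  have "x \<in> ring_module.span {1}" for x :: 'a
    using ring_module.span_scale[OF ring_module.span_base[of 1 "{1}"], of x] by simp
  then show ?case by (intro exI[of _ "{1}"]) auto
next
  case (Suc k)
  then obtain B where B: "finite B" "ideal_power (ideal_gen A) k = ring_module.span B" by blast
  let ?C = "(\<lambda>(a, b). a * b) ` (A \<times> B)"
  let ?P = "{a * b | a b. a \<in> ring_module.span A \<and> b \<in> ring_module.span B}"
  have *: "a * y \<in> ring_module.span ?C" if "a \<in> A" "y \<in> ring_module.span B" for a y
    using that(2)
  proof (induction rule: ring_module.span_induct_alt)
    case base
    then show ?case by (simp add: ring_module.span_zero)
  next
    case (step c b y)
    have "a * (c * b + y) = c * (a * b) + a * y" by (simp only: distrib_left mult.left_commute)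
    moreover have "a * b \<in> ring_module.span ?C"
      using that(1) step by (intro ring_module.span_base) auto
    ultimately show ?case
      using step.IH by (simp only: ring_module.span_add ring_module.span_scale)
  qed
  have "x * y \<in> ring_module.span ?C" if "x \<in> ring_module.span A" "y \<in> ring_module.span B" for x y
    using that(1)
  proof (induction rule: ring_module.span_induct_alt)
    case base
    then show ?case by (simp add: ring_module.span_zero)
  next
    case (step c a x)
    have "(c * a + x) * y = c * (a * y) + x * y" by (simp only: distrib_right mult.assoc)
    moreover have "a * y \<in> ring_module.span ?C"
      using * step.hyps that(2) by blast
    ultimately show ?case
      using step.IH by (simp only: ring_module.span_add ring_module.span_scale)
  qed
  then have "ring_module.span ?P \<subseteq> ring_module.span ?C"
    by (intro ring_module.span_minimal ring_module.subspace_span) blast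
  moreover have "ring_module.span ?C \<subseteq> ring_module.span ?P"
  proof (intro ring_module.span_mono subsetI)
    fix z assume "z \<in> ?C"
    then obtain a b where "z = a * b" "a \<in> A" "b \<in> B" by auto
    then show "z \<in> ?P"
      using ring_module.span_base[of a A] ring_module.span_base[of b B] by blast
  qed
  ultimately have "ideal_power (ideal_gen A) (Suc k) = ring_module.span ?C"
    using B by (simp add: ideal_gen_def)
  then show ?case using assms B(1) by (intro exI[of _ ?C]) simp
qed

lemma single_in_max_ideal_power:
  "Poly_Mapping.single (Poly_Mapping.single i k) 1
    \<in> (ideal_power max_ideal k :: ('n, 'k::field) mpoly set)"
proof (induction k)
  case 0
  then show ?case by simp
next
  case (Suc k)
  have "Poly_Mapping.single (Poly_Mapping.single i (Suc k)) 1
      = (mvar i * Poly_Mapping.single (Poly_Mapping.single i k) 1 :: ('n, 'k) mpoly)"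
    by (simp add: mvar_def mult_single flip: single_add)
  moreover have "mvar i \<in> (max_ideal :: ('n, 'k) mpoly set)"
    by (simp add: max_ideal_def ideal_gen_def ring_module.span_base)
  ultimately show ?case
    using Suc by (auto simp: ideal_gen_def intro!: ring_module.span_base)
qed

lemma monomial_degree_add: "monomial_degree (u + v) = monomial_degree u + monomial_degree v"
  by (simp add: monomial_degree_def vec_eq_iff lookup_add)

lemma lookup_ideal_part_sum:
  fixes f :: "('n::finite, 'k::field) mpoly"
  assumes "\<forall>a. c a \<in> ideal_part I a" and "finite {a. c a \<noteq> 0}" and "f = (\<Sum>a | c a \<noteq> 0. c a)"
  shows "Poly_Mapping.lookup (c a) u = (if monomial_degree u = a then Poly_Mapping.lookup f u else 0)"
proof -
  have zero: "Poly_Mapping.lookup (c b) u = 0" if "monomial_degree u \<noteq> b" for b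
    using assms(1) that unfolding ideal_part_def mpoly_part_def
    by (metis (mono_tags, lifting) IntD2 in_keys_iff mem_Collect_eq)
  have "Poly_Mapping.lookup f u = (\<Sum>b | c b \<noteq> 0. Poly_Mapping.lookup (c b) u)"
    by (simp add: assms(3) lookup_sum)
  also have "\<dots> = (\<Sum>b | c b \<noteq> 0. if b = monomial_degree u then Poly_Mapping.lookup (c b) u else 0)"
    using zero by (intro sum.cong) auto
  also have "\<dots> = Poly_Mapping.lookup (c (monomial_degree u)) u"
    using assms(2) by simp
  finally show ?thesis using zero by auto
qed

lemma multigraded_module_max_ideal_power:
  "multigraded_module (*) (ideal_power max_ideal k :: ('n::finite, 'k::field) mpoly set)
    (ideal_part (ideal_power max_ideal k))"
proof
  let ?I = "ideal_power max_ideal k :: ('n, 'k) mpoly set"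
  show "ring_module.subspace ?I" by (rule subspace_ideal_power)
  show "\<exists>B. finite B \<and> ?I = ring_module.span B"
    unfolding max_ideal_def by (rule finitely_generated_ideal_power) simp
  have "Poly_Mapping.single (Poly_Mapping.single (undefined :: 'n) k) (1 :: 'k) \<in> ?I"
    by (rule single_in_max_ideal_power)
  then show "?I \<noteq> {0}"
    by (metis keys_single keys_zero insert_not_empty singletonD zero_neq_one)
  show "ideal_part ?I a \<subseteq> ?I" for a by (simp add: ideal_part_def)
  show "0 \<in> ideal_part ?I a" for a
    by (simp add: ideal_part_def mpoly_part_def ring_module.subspace_0 subspace_ideal_power)
  show "x + y \<in> ideal_part ?I a" if "x \<in> ideal_part ?I a" "y \<in> ideal_part ?I a" for x y a
    using that keys_add[of x y] ring_module.subspace_add[OF subspace_ideal_power]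
    by (fastforce simp: ideal_part_def mpoly_part_def)
  show "p * x \<in> ideal_part ?I (b + a)" if "p \<in> mpoly_part b" "x \<in> ideal_part ?I a" for p x a b
    using that keys_mult[of p x] ring_module.subspace_scale[OF subspace_ideal_power]
    by (fastforce simp: ideal_part_def mpoly_part_def monomial_degree_add)
  show "\<exists>!c. (\<forall>a. c a \<in> ideal_part ?I a) \<and> finite {a. c a \<noteq> 0} \<and> f = (\<Sum>a | c a \<noteq> 0. c a)"
    if f: "f \<in> ?I" for f
  proof (rule ex_ex1I)
    let ?t = "\<lambda>u. Poly_Mapping.single u (Poly_Mapping.lookup f u)"
    let ?K = "Poly_Mapping.keys f"
    define c where "c a = (\<Sum>u\<in>{u\<in>?K. monomial_degree u = a}. ?t u)" for a
    have "?t u \<in> ?I" if "u \<in> ?K" for u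
    proof -
      have "?t u = Poly_Mapping.single 0 (Poly_Mapping.lookup f u) * Poly_Mapping.single u 1"
        by (simp add: mult_single)
      then show ?thesis
        using monomials_in_max_ideal_power[OF f that]
          ring_module.subspace_scale[OF subspace_ideal_power] by metis
    qed
    then have "c a \<in> ?I" for a
      unfolding c_def by (intro ring_module.subspace_sum[OF subspace_ideal_power]) simp
    moreover have "c a \<in> mpoly_part a" for a
      unfolding c_def mpoly_part_def
      using keys_sum[of ?t "{u\<in>?K. monomial_degree u = a}"] by fastforce
    ultimately have part: "\<forall>a. c a \<in> ideal_part ?I a" by (simp add: ideal_part_def)
    have sub: "{a. c a \<noteq> 0} \<subseteq> monomial_degree ` ?K"
    proof
      fix a assume "a \<in> {a. c a \<noteq> 0}"
      then have "{u\<in>?K. monomial_degree u = a} \<noteq> {}" unfolding c_def by force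
      then show "a \<in> monomial_degree ` ?K" by auto
    qed
    have "f = (\<Sum>u\<in>?K. ?t u)"
      by (rule poly_mapping_eqI) (simp add: lookup_sum lookup_single when_def in_keys_iff)
    also have "\<dots> = (\<Sum>a\<in>monomial_degree ` ?K. c a)"
      unfolding c_def by (rule sum.image_gen) simp
    also have "\<dots> = (\<Sum>a | c a \<noteq> 0. c a)"
      using sub by (intro sum.mono_neutral_right) auto
    finally have sum: "f = (\<Sum>a | c a \<noteq> 0. c a)" .
    have "finite {a. c a \<noteq> 0}"
      using finite_subset[OF sub] by simp
    with part sum show "\<exists>c. (\<forall>a. c a \<in> ideal_part ?I a) \<and> finite {a. c a \<noteq> 0} \<and> f = (\<Sum>a | c a \<noteq> 0. c a)"
      by (intro exI[of _ c] conjI)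
  next
    fix c d
    assume c: "(\<forall>a. c a \<in> ideal_part ?I a) \<and> finite {a. c a \<noteq> 0} \<and> f = (\<Sum>a | c a \<noteq> 0. c a)"
      and d: "(\<forall>a. d a \<in> ideal_part ?I a) \<and> finite {a. d a \<noteq> 0} \<and> f = (\<Sum>a | d a \<noteq> 0. d a)"
    show "c = d"
    proof (rule ext, rule poly_mapping_eqI)
      fix a u
      have "Poly_Mapping.lookup (c a) u = (if monomial_degree u = a then Poly_Mapping.lookup f u else 0)"
        using c by (elim conjE) (rule lookup_ideal_part_sum)
      also have "\<dots> = Poly_Mapping.lookup (d a) u"
        using d by (elim conjE) (rule lookup_ideal_part_sum[symmetric])
      finally show "Poly_Mapping.lookup (c a) u = Poly_Mapping.lookup (d a) u" .
    qed
  qed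
qed

end

end

theory Submission
  imports Defs
begin

text \<open>
  A Stanley decomposition of \<open>\<^bold>m\<^sup>k\<close> partitions the monomials of degree at least \<open>k\<close> into cells
  \<open>u\<^sub>i \<cdot> Mon(Z\<^sub>i)\<close>.  By minimality of its degree, each monomial \<open>u\<close> of degree \<open>k\<close> is one of the \<open>u\<^sub>i\<close>, and
  its cell contains \<open>|Z\<^sub>i|\<close> monomials of degree \<open>k + 1\<close>.  These are distinct for distinct \<open>u\<close>, so a
  decomposition of depth \<open>d\<close> yields \<open>d \<cdot> |S\<^sub>k| \<le> |S\<^sub>k\<^sub>+\<^sub>1|\<close> for the numbers of monomials, whose ratio is
  \<open>(n + k) / (k + 1)\<close>.  In the other direction, after ordering the variables, the Eliahou--Kervaire cells of
  the monomials \<open>u\<close> of degree \<open>k\<close>, with \<open>Z\<close> the variables not before the last one in \<open>u\<close>, form a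
  decomposition of depth at least 1.
\<close>

section \<open>Total degree and powers of the maximal ideal\<close>

definition total_degree :: "('n::finite \<Rightarrow>\<^sub>0 nat) \<Rightarrow> nat"
  where "total_degree u = (\<Sum>i\<in>UNIV. Poly_Mapping.lookup u i)"

lemma total_degree_zero [simp]: "total_degree 0 = 0"
  by (simp add: total_degree_def)

lemma total_degree_add [simp]: "total_degree (u + v) = total_degree u + total_degree v"
  by (simp add: total_degree_def lookup_add sum.distrib)

lemma total_degree_single [simp]: "total_degree (Poly_Mapping.single i c) = c"
  by (simp add: total_degree_def lookup_single when_def)

lemma total_degree_eq_0_iff [simp]: "total_degree u = 0 \<longleftrightarrow> u = 0"
proof
  assume "total_degree u = 0"
  then show "u = 0" by (intro poly_mapping_eqI) (simp add: total_degree_def)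
qed simp

lemma keys_sum_list: "Poly_Mapping.keys (sum_list vs) \<subseteq> (\<Union>v\<in>set vs. Poly_Mapping.keys v)"
proof (induction vs)
  case (Cons v vs)
  then show ?case using keys_add[of v "sum_list vs"] by auto
qed simp

lemma in_keys_imp_split:
  fixes u :: "'n \<Rightarrow>\<^sub>0 nat"
  assumes "i \<in> Poly_Mapping.keys u"
  obtains v where "u = v + Poly_Mapping.single i 1"
proof
  show "u = (u - Poly_Mapping.single i 1) + Poly_Mapping.single i 1"
    using assms
    by (intro poly_mapping_eqI)
      (auto simp: lookup_add lookup_minus lookup_single when_def in_keys_iff)
qed

text \<open>Adding elements creates no new monomials, and multiplying by a ring element only raises
  degrees, so a lower bound on the degrees in a generating set survives span induction.\<close>

lemma total_degree_ideal_gen: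
  fixes B :: "('n::finite, 'k::field) mpoly set"
  assumes "\<And>b u. b \<in> B \<Longrightarrow> u \<in> Poly_Mapping.keys b \<Longrightarrow> d \<le> total_degree u"
    and "p \<in> ideal_gen B" and "u \<in> Poly_Mapping.keys p"
  shows "d \<le> total_degree u"
  using assms(2,3) unfolding ideal_gen_def
proof (induction arbitrary: u rule: module.span_induct_alt[OF module_mult, consumes 1, case_names base step])
  case base
  then show ?case by simp
next
  case (step c b y)
  from step.prems keys_add[of "c * b" y]
  consider "u \<in> Poly_Mapping.keys (c * b)" | "u \<in> Poly_Mapping.keys y" by auto
  then show ?case
  proof cases
    case 1
    then obtain s t where "u = s + t" and "t \<in> Poly_Mapping.keys b"
      using keys_mult[of c b] by blast
    then show ?thesis using assms(1)[OF step.hyps(1), of t] by simp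
  qed (rule step.IH)
qed

lemma poly_mapping_eq_sum_monomials:
  "p = (\<Sum>u\<in>Poly_Mapping.keys p. Poly_Mapping.single u (Poly_Mapping.lookup p u))"
  by (rule poly_mapping_eqI) (simp add: lookup_sum lookup_single when_def in_keys_iff)

lemma total_degree_max_ideal_power:
  fixes p :: "('n::finite, 'k::field) mpoly"
  assumes "p \<in> ideal_power max_ideal k" and "u \<in> Poly_Mapping.keys p"
  shows "k \<le> total_degree u"
  using assms
proof (induction k arbitrary: p u)
  case 0
  then show ?case by simp
next
  case (Suc k)
  show ?case
  proof (rule total_degree_ideal_gen)
    fix b :: "('n, 'k) mpoly" and u
    assume "b \<in> {a * b | a b. a \<in> max_ideal \<and> b \<in> ideal_power max_ideal k}"
      and u: "u \<in> Poly_Mapping.keys b"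
    then obtain x y where b: "b = x * y" "x \<in> max_ideal" "y \<in> ideal_power max_ideal k"
      by blast
    with u keys_mult[of x y] obtain s t where st: "u = s + t"
      "s \<in> Poly_Mapping.keys x" "t \<in> Poly_Mapping.keys y" by blast
    have "1 \<le> total_degree s"
      using b(2) st(2) unfolding max_ideal_def
      by (rule total_degree_ideal_gen[rotated]) (auto simp: mvar_def)
    with Suc.IH[OF b(3) st(3)] show "Suc k \<le> total_degree u" by (simp add: st(1))
  qed (use Suc.prems in auto)
qed

text \<open>Induction on \<open>k\<close>, splitting off one variable that divides \<open>u\<close>
  at each step.\<close>

lemma monomial_in_max_ideal_power:
  fixes u :: "'n::finite \<Rightarrow>\<^sub>0 nat"
  assumes "k \<le> total_degree u"
  shows "Poly_Mapping.single u 1 \<in> (ideal_power max_ideal k :: ('n, 'k::field) mpoly set)"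
  using assms
proof (induction k arbitrary: u)
  case 0
  then show ?case by simp
next
  case (Suc k)
  then have "u \<noteq> 0" by auto
  then obtain i where "i \<in> Poly_Mapping.keys u" by fastforce
  then obtain v where u: "u = v + Poly_Mapping.single i 1" by (rule in_keys_imp_split)
  then have "Poly_Mapping.single v 1 \<in> (ideal_power max_ideal k :: ('n, 'k) mpoly set)"
    using Suc by simp
  moreover have "Poly_Mapping.single u 1 = mvar i * (Poly_Mapping.single v 1 :: ('n, 'k) mpoly)"
    by (simp add: u mvar_def mult_single add.commute)
  moreover have "mvar i \<in> (max_ideal :: ('n, 'k) mpoly set)"
    by (simp add: max_ideal_def ideal_gen_def module.span_base[OF module_mult])
  ultimately show ?case
    by (auto simp: ideal_gen_def intro!: module.span_base[OF module_mult])
qed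

text \<open>Replaces the recursive ideal power by a condition on supports, the only description of
  it used in the translation to monomials.\<close>

lemma in_max_ideal_power_iff:
  fixes p :: "('n::finite, 'k::field) mpoly"
  shows "p \<in> ideal_power max_ideal k \<longleftrightarrow> (\<forall>u\<in>Poly_Mapping.keys p. k \<le> total_degree u)"
proof
  assume *: "\<forall>u\<in>Poly_Mapping.keys p. k \<le> total_degree u"
  have "Poly_Mapping.single u c \<in> (ideal_power max_ideal k :: ('n, 'k) mpoly set)"
    if "k \<le> total_degree u" for u c
    using module.subspace_scale[OF module_mult subspace_ideal_power
        monomial_in_max_ideal_power[OF that], of "Poly_Mapping.single 0 c"]
    by (simp add: mult_single)
  with * have "(\<Sum>u\<in>Poly_Mapping.keys p. Poly_Mapping.single u (Poly_Mapping.lookup p u))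
      \<in> ideal_power max_ideal k"
    by (intro module.subspace_sum[OF module_mult subspace_ideal_power]) simp
  then show "p \<in> ideal_power max_ideal k"
    by (simp flip: poly_mapping_eq_sum_monomials)
qed (use total_degree_max_ideal_power in blast)

section \<open>Stanley decompositions as partitions of monomials\<close>

text \<open>Applied to \<open>m\<close> with one key \<open>u\<close>, this is the monomial basis of
  the Stanley space of \<open>m\<close> and \<open>Z\<close>. Ranging over all keys of
  \<open>m\<close> avoids extracting the exponent vector.\<close>

fun cell :: "('n, 'k::field) mpoly \<times> 'n set \<Rightarrow> ('n \<Rightarrow>\<^sub>0 nat) set"
  where "cell (m, Z) = {t + u | t u. Poly_Mapping.keys t \<subseteq> Z \<and> u \<in> Poly_Mapping.keys m}"

lemma mult_single_eq_sum:
  fixes p :: "('n, 'k::field) mpoly"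
  shows "p * Poly_Mapping.single u c =
    (\<Sum>t\<in>Poly_Mapping.keys p. Poly_Mapping.single (t + u) (Poly_Mapping.lookup p t * c))"
proof -
  have "p * Poly_Mapping.single u c =
    (\<Sum>t\<in>Poly_Mapping.keys p. Poly_Mapping.single t (Poly_Mapping.lookup p t)) * Poly_Mapping.single u c"
    by (simp flip: poly_mapping_eq_sum_monomials)
  then show ?thesis by (simp add: sum_distrib_right mult_single)
qed

text \<open>Translation by \<open>u\<close> is injective on exponent vectors, so no terms merge or
  cancel.\<close>

lemma keys_mult_single:
  fixes p :: "('n, 'k::field) mpoly"
  assumes "c \<noteq> 0"
  shows "Poly_Mapping.keys (p * Poly_Mapping.single u c) = (\<lambda>t. t + u) ` Poly_Mapping.keys p"
proof
  show "Poly_Mapping.keys (p * Poly_Mapping.single u c) \<subseteq> (\<lambda>t. t + u) ` Poly_Mapping.keys p"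
    using keys_mult[of p "Poly_Mapping.single u c"] assms by auto
  have "Poly_Mapping.lookup (p * Poly_Mapping.single u c) (t + u) = Poly_Mapping.lookup p t * c" for t
    by (simp add: mult_single_eq_sum lookup_sum lookup_single when_def in_keys_iff)
  then show "(\<lambda>t. t + u) ` Poly_Mapping.keys p \<subseteq> Poly_Mapping.keys (p * Poly_Mapping.single u c)"
    using assms by (auto simp: in_keys_iff)
qed

lemma keys_eq_singleton_imp_single:
  fixes m :: "'a \<Rightarrow>\<^sub>0 'b::comm_monoid_add"
  assumes "Poly_Mapping.keys m = {u}"
  obtains c where "c \<noteq> 0" and "m = Poly_Mapping.single u c"
proof
  show "Poly_Mapping.lookup m u \<noteq> 0" using assms by (simp flip: in_keys_iff)
  show "m = Poly_Mapping.single u (Poly_Mapping.lookup m u)"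
    using poly_mapping_eq_sum_monomials[of m] assms by simp
qed

text \<open>A Stanley space generated by a term consists of all polynomials supported on its cell.
  This makes directness of a sum a purely combinatorial matter.\<close>

lemma multiples_of_monomial:
  fixes m :: "('n, 'k::field) mpoly"
  assumes "Poly_Mapping.keys m = {u}"
  shows "{p * m | p. p \<in> subalgebra Z} = {q. Poly_Mapping.keys q \<subseteq> cell (m, Z)}"
proof -
  obtain c where c: "c \<noteq> 0" "m = Poly_Mapping.single u c"
    using assms by (rule keys_eq_singleton_imp_single)
  show ?thesis
  proof (intro subset_antisym subsetI)
    fix q assume "q \<in> {p * m | p. p \<in> subalgebra Z}"
    then show "q \<in> {q. Poly_Mapping.keys q \<subseteq> cell (m, Z)}"
      using c by (auto simp: keys_mult_single subalgebra_def)
  next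
    fix q :: "('n, 'k) mpoly" assume "q \<in> {q. Poly_Mapping.keys q \<subseteq> cell (m, Z)}"
    then have q: "\<And>w. w \<in> Poly_Mapping.keys q \<Longrightarrow> \<exists>t. Poly_Mapping.keys t \<subseteq> Z \<and> w = t + u"
      using assms by fastforce
    \<comment> \<open>The cofactor of \<open>q\<close> is found by dividing each of its terms by
      \<open>m\<close>.\<close>
    let ?s = "\<lambda>w. Poly_Mapping.single (w - u) (Poly_Mapping.lookup q w / c)"
    let ?p = "\<Sum>w\<in>Poly_Mapping.keys q. ?s w"
    have "?p \<in> subalgebra Z"
      using keys_sum[of ?s "Poly_Mapping.keys q"] q c(1)
      by (fastforce simp: subalgebra_def split: if_splits)
    moreover have "?p * m = (\<Sum>w\<in>Poly_Mapping.keys q. Poly_Mapping.single w (Poly_Mapping.lookup q w))"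
      unfolding sum_distrib_right
    proof (rule sum.cong[OF refl])
      fix w assume "w \<in> Poly_Mapping.keys q"
      with q obtain t where "w = t + u" by blast
      then show "?s w * m = Poly_Mapping.single w (Poly_Mapping.lookup q w)"
        using c by (simp add: mult_single)
    qed
    ultimately show "q \<in> {p * m | p. p \<in> subalgebra Z}"
      by (auto simp flip: poly_mapping_eq_sum_monomials intro!: exI[of _ ?p])
  qed
qed

section \<open>Direct sums of coordinate subspaces and partitions of index sets\<close>

lemma lookup_sum_list_nth:
  "Poly_Mapping.lookup (sum_list vs) w = (\<Sum>i<length vs. Poly_Mapping.lookup (vs ! i) w)"
  by (simp add: sum_list_sum_nth lookup_sum atLeast0LessThan)

text \<open>Test the direct sum on the single term at \<open>w\<close>: existence of a decomposition
  puts \<open>w\<close> into some set, and two such sets would give two decompositions.\<close>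

lemma partition_if_direct_sum:
  fixes W :: "'a set" and Cs :: "'a set list"
  assumes "\<And>x :: 'a \<Rightarrow>\<^sub>0 'k::field. Poly_Mapping.keys x \<subseteq> W \<Longrightarrow>
      \<exists>!vs. list_all2 (\<lambda>v C. Poly_Mapping.keys v \<subseteq> C) vs Cs \<and> x = sum_list vs"
    and "w \<in> W"
  shows "\<exists>!i. i < length Cs \<and> w \<in> Cs ! i"
proof -
  let ?x = "Poly_Mapping.single w (1 :: 'k)"
  have ex1: "\<exists>!vs. list_all2 (\<lambda>v C. Poly_Mapping.keys v \<subseteq> C) vs Cs \<and> ?x = sum_list vs"
    using assms by simp
  then obtain vs where vs: "list_all2 (\<lambda>v C. Poly_Mapping.keys v \<subseteq> C) vs Cs" "?x = sum_list vs"
    by blast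
  have "w \<in> Poly_Mapping.keys (sum_list vs)" by (simp flip: vs(2))
  then obtain i where i: "i < length vs" "w \<in> Poly_Mapping.keys (vs ! i)"
    using keys_sum_list[of vs] by (fastforce simp: in_set_conv_nth)
  show ?thesis
  proof
    show "i < length Cs \<and> w \<in> Cs ! i"
      using i vs(1) by (auto simp: list_all2_conv_all_nth)
  next
    \<comment> \<open>The decomposition that places the whole term in position
      \<open>j\<close>.\<close>
    let ?v = "\<lambda>j. map (\<lambda>l. if l = j then ?x else 0) [0..<length Cs]"
    have *: "list_all2 (\<lambda>v C. Poly_Mapping.keys v \<subseteq> C) (?v j) Cs \<and> ?x = sum_list (?v j)"
      if "j < length Cs \<and> w \<in> Cs ! j" for j
      using that by (auto simp: list_all2_conv_all_nth interv_sum_list_conv_sum_set_nat)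
    fix j assume j: "j < length Cs \<and> w \<in> Cs ! j"
    have i': "i < length Cs \<and> w \<in> Cs ! i"
      using i vs(1) by (auto simp: list_all2_conv_all_nth)
    have "?v i = ?v j" using ex1 *[OF j] *[OF i'] by blast
    then have "?v i ! i = ?v j ! i" by (rule arg_cong)
    moreover have "?x \<noteq> 0" by (simp flip: keys_eq_empty)
    ultimately show "j = i" using i' by (simp split: if_splits)
  qed
qed

text \<open>The component belonging to each set is forced to be the restriction of \<open>x\<close>
  to that set, and these restrictions add up to \<open>x\<close>.\<close>

lemma direct_sum_if_partition:
  fixes x :: "'a \<Rightarrow>\<^sub>0 'k::field"
  assumes "\<And>w. w \<in> W \<Longrightarrow> \<exists>!i. i < length Cs \<and> w \<in> Cs ! i"
    and "\<And>C. C \<in> set Cs \<Longrightarrow> C \<subseteq> W"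
    and "Poly_Mapping.keys x \<subseteq> W"
  shows "\<exists>!vs. list_all2 (\<lambda>v C. Poly_Mapping.keys v \<subseteq> C) vs Cs \<and> x = sum_list vs"
proof -
  let ?P = "\<lambda>vs. list_all2 (\<lambda>v C. Poly_Mapping.keys v \<subseteq> C) vs Cs \<and> x = sum_list vs"
  \<comment> \<open>Uniqueness: at a point of the \<open>i\<close>-th set all other components
    vanish by disjointness, so the \<open>i\<close>-th one carries the whole coefficient of
    \<open>x\<close>.\<close>
  have lookup: "Poly_Mapping.lookup (vs ! i) w = (if w \<in> Cs ! i then Poly_Mapping.lookup x w else 0)"
    if vs: "?P vs" and i: "i < length Cs" for vs i w
  proof (cases "w \<in> Cs ! i")
    case True
    then have "w \<in> W" using assms(2) i by (meson nth_mem subsetD)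
    have "Poly_Mapping.lookup (vs ! j) w = 0" if "j < length Cs" "j \<noteq> i" for j
    proof -
      have "w \<notin> Cs ! j" using assms(1)[OF \<open>w \<in> W\<close>] True i that by blast
      moreover have "Poly_Mapping.keys (vs ! j) \<subseteq> Cs ! j"
        using vs that(1) by (auto simp: list_all2_conv_all_nth)
      ultimately show ?thesis by (meson in_keys_iff subsetD)
    qed
    then have "(\<Sum>j<length vs. Poly_Mapping.lookup (vs ! j) w) =
        (\<Sum>j<length vs. if j = i then Poly_Mapping.lookup (vs ! j) w else 0)"
      using vs by (intro sum.cong) (auto dest: list_all2_lengthD)
    also have "\<dots> = Poly_Mapping.lookup (vs ! i) w"
      using vs i by (auto dest: list_all2_lengthD)
    finally show ?thesis using vs True by (simp add: lookup_sum_list_nth)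
  next
    case False
    moreover have "Poly_Mapping.keys (vs ! i) \<subseteq> Cs ! i"
      using vs i by (auto simp: list_all2_conv_all_nth)
    ultimately show ?thesis by (auto simp: in_keys_iff)
  qed
  \<comment> \<open>Existence: \<open>r C\<close> is the restriction of \<open>x\<close> to
    \<open>C\<close>.\<close>
  define r where "r C = (\<Sum>w\<in>Poly_Mapping.keys x \<inter> C. Poly_Mapping.single w (Poly_Mapping.lookup x w))" for C
  have lookup_r: "Poly_Mapping.lookup (r C) w = (if w \<in> C then Poly_Mapping.lookup x w else 0)" for C w
    by (simp add: r_def lookup_sum lookup_single when_def in_keys_iff)
  have "x = sum_list (map r Cs)"
  proof (rule poly_mapping_eqI)
    fix w
    have "Poly_Mapping.lookup (sum_list (map r Cs)) w =
        (\<Sum>i<length Cs. if w \<in> Cs ! i then Poly_Mapping.lookup x w else 0)"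
      by (simp add: lookup_sum_list_nth lookup_r cong: sum.cong_simp)
    also have "\<dots> = Poly_Mapping.lookup x w"
    proof (cases "w \<in> W")
      case True
      then obtain i where i: "i < length Cs" "w \<in> Cs ! i"
        and uniq: "\<And>j. j < length Cs \<Longrightarrow> w \<in> Cs ! j \<Longrightarrow> j = i"
        using assms(1) by blast
      have "(\<Sum>j<length Cs. if w \<in> Cs ! j then Poly_Mapping.lookup x w else 0) =
          (\<Sum>j<length Cs. if j = i then Poly_Mapping.lookup x w else 0)"
      proof (rule sum.cong[OF refl])
        fix j assume "j \<in> {..<length Cs}"
        then have "w \<in> Cs ! j \<longleftrightarrow> j = i" using i uniq by blast
        then show "(if w \<in> Cs ! j then Poly_Mapping.lookup x w else 0) =
            (if j = i then Poly_Mapping.lookup x w else 0)" by simp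
      qed
      then show ?thesis using i by simp
    next
      case False
      then have "Poly_Mapping.lookup x w = 0" using assms(3) by (auto simp: in_keys_iff)
      then show ?thesis by (simp cong: if_cong)
    qed
    finally show "Poly_Mapping.lookup x w = Poly_Mapping.lookup (sum_list (map r Cs)) w" ..
  qed
  moreover have "list_all2 (\<lambda>v C. Poly_Mapping.keys v \<subseteq> C) (map r Cs) Cs"
    by (auto simp: list_all2_conv_all_nth in_keys_iff lookup_r split: if_splits)
  ultimately have ex: "\<exists>vs. ?P vs" by blast
  have uniq: "vs = vs'" if "?P vs" "?P vs'" for vs vs'
  proof (rule nth_equalityI)
    have len: "length vs = length Cs" "length vs' = length Cs"
      using that list_all2_lengthD by blast+
    then show "length vs = length vs'" by simp
    show "vs ! i = vs' ! i" if "i < length vs" for i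
      using that lookup[OF \<open>?P vs\<close>, of i] lookup[OF \<open>?P vs'\<close>, of i] len
      by (intro poly_mapping_eqI) simp
  qed
  show ?thesis using ex uniq by (rule ex_ex1I)
qed

section \<open>Stanley decompositions of powers of the maximal ideal\<close>

text \<open>The reason why a nonzero homogeneous polynomial is a scalar multiple of a single
  monomial.\<close>

lemma monomial_degree_eq_iff: "monomial_degree u = monomial_degree v \<longleftrightarrow> u = v"
  by (auto simp: monomial_degree_def vec_eq_iff intro: poly_mapping_eqI)

abbreviation stanley_decomposition_power :: "nat \<Rightarrow> (('n::finite, 'k::field) mpoly \<times> 'n set) list \<Rightarrow> bool"
  where "stanley_decomposition_power k \<equiv> multigraded_module.stanley_decomposition (*)
    (ideal_power max_ideal k) (ideal_part (ideal_power max_ideal k))"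

lemma stanley_decomposition_power_iff:
  fixes D :: "(('n::finite, 'k::field) mpoly \<times> 'n set) list"
  shows "stanley_decomposition_power k D \<longleftrightarrow>
    (\<forall>(m, Z)\<in>set D. \<exists>u. Poly_Mapping.keys m = {u} \<and> k \<le> total_degree u) \<and>
    (\<forall>w. k \<le> total_degree w \<longrightarrow> (\<exists>!i. i < length D \<and> w \<in> cell (D ! i)))"
proof -
  let ?I = "ideal_power max_ideal k :: ('n, 'k) mpoly set"
  let ?W = "{w :: 'n \<Rightarrow>\<^sub>0 nat. k \<le> total_degree w}"
  note mgm = multigraded_module_max_ideal_power[of k, where ?'n = 'n and ?'k = 'k]
  have "(m \<in> ?I \<and> multigraded_module.homogeneous (ideal_part ?I) m \<and>
      (\<forall>p\<in>subalgebra Z. p \<noteq> 0 \<longrightarrow> p * m \<noteq> 0)) \<longleftrightarrow>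
      (\<exists>u. Poly_Mapping.keys m = {u} \<and> k \<le> total_degree u)" (is "?L \<longleftrightarrow> ?R") for m :: "('n, 'k) mpoly" and Z
  proof
    assume ?L
    \<comment> \<open>Freeness applied to the scalar 1 shows that the generator is nonzero.\<close>
    have "1 \<in> (subalgebra Z :: ('n, 'k) mpoly set)" by (simp add: subalgebra_def)
    with \<open>?L\<close> have "m \<noteq> 0" by (metis mult_1 zero_neq_one)
    then obtain u where u: "u \<in> Poly_Mapping.keys m" by fastforce
    from \<open>?L\<close> obtain a where "\<forall>v\<in>Poly_Mapping.keys m. monomial_degree v = a"
      by (auto simp: multigraded_module.homogeneous_def[OF mgm] ideal_part_def mpoly_part_def)
    with u have "Poly_Mapping.keys m = {u}"
      by (auto simp flip: monomial_degree_eq_iff)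
    with \<open>?L\<close> show ?R by (auto simp: in_max_ideal_power_iff)
  next
    assume ?R
    then obtain u where u: "Poly_Mapping.keys m = {u}" "k \<le> total_degree u" by blast
    obtain c where c: "c \<noteq> 0" "m = Poly_Mapping.single u c"
      using u(1) by (rule keys_eq_singleton_imp_single)
    have "m \<in> ?I" using u by (simp add: in_max_ideal_power_iff)
    moreover have "m \<in> ideal_part ?I (monomial_degree u)"
      using \<open>m \<in> ?I\<close> u by (simp add: ideal_part_def mpoly_part_def)
    moreover have "p * m \<noteq> 0" if "p \<noteq> 0" for p
      using keys_mult_single[OF c(1), of p u] that by (auto simp flip: keys_eq_empty simp: c(2))
    ultimately show ?L by (auto simp: multigraded_module.homogeneous_def[OF mgm])
  qed
  then have generators: "(\<forall>(m, Z)\<in>set D. m \<in> ?I \<and> multigraded_module.homogeneous (ideal_part ?I) m \<and>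
      (\<forall>p\<in>subalgebra Z. p \<noteq> 0 \<longrightarrow> p * m \<noteq> 0)) \<longleftrightarrow>
      (\<forall>(m, Z)\<in>set D. \<exists>u. Poly_Mapping.keys m = {u} \<and> k \<le> total_degree u)" (is "_ \<longleftrightarrow> ?G")
    by auto
  \<comment> \<open>The sum condition is translated under \<open>?G\<close>, since only generators
    with one monomial have Stanley spaces determined by their cells; \<open>conj_cong\<close>
    supplies this assumption at the end.\<close>
  have "(\<forall>x\<in>?I. \<exists>!vs. list_all2 (\<lambda>v (m, Z). v \<in> multigraded_module.stanley_space (*) m Z) vs D \<and> x = sum_list vs)
    \<longleftrightarrow> (\<forall>w. k \<le> total_degree w \<longrightarrow> (\<exists>!i. i < length D \<and> w \<in> cell (D ! i)))" if ?G
  proof -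
    have "v \<in> multigraded_module.stanley_space (*) m Z \<longleftrightarrow> Poly_Mapping.keys v \<subseteq> cell (m, Z)"
      if "(m, Z) \<in> set D" for m v Z
    proof -
      from \<open>?G\<close> that obtain u where "Poly_Mapping.keys m = {u}" by blast
      then show ?thesis
        by (simp only: multigraded_module.stanley_space_def[OF mgm] multiples_of_monomial mem_Collect_eq)
    qed
    then have "list_all2 (\<lambda>v (m, Z). v \<in> multigraded_module.stanley_space (*) m Z) vs D \<longleftrightarrow>
        list_all2 (\<lambda>v C. Poly_Mapping.keys v \<subseteq> C) vs (map cell D)" for vs
      unfolding list.rel_map by (intro list.rel_cong[OF refl refl]) (auto simp del: cell.simps)
    then have "(\<forall>x\<in>?I. \<exists>!vs. list_all2 (\<lambda>v (m, Z). v \<in> multigraded_module.stanley_space (*) m Z) vs D \<and> x = sum_list vs)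
      \<longleftrightarrow> (\<forall>x. Poly_Mapping.keys x \<subseteq> ?W \<longrightarrow> (\<exists>!vs :: ('n, 'k) mpoly list.
        list_all2 (\<lambda>v C. Poly_Mapping.keys v \<subseteq> C) vs (map cell D) \<and> x = sum_list vs))"
      by (simp add: Ball_def in_max_ideal_power_iff subset_iff)
    also have "\<dots> \<longleftrightarrow> (\<forall>w\<in>?W. \<exists>!i. i < length (map cell D) \<and> w \<in> map cell D ! i)"
    proof (intro iffI ballI allI impI)
      fix w
      assume *: "\<forall>x. Poly_Mapping.keys x \<subseteq> ?W \<longrightarrow> (\<exists>!vs :: ('n, 'k) mpoly list.
        list_all2 (\<lambda>v C. Poly_Mapping.keys v \<subseteq> C) vs (map cell D) \<and> x = sum_list vs)"
        and "w \<in> ?W"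
      then show "\<exists>!i. i < length (map cell D) \<and> w \<in> map cell D ! i"
        by (intro partition_if_direct_sum[OF *[rule_format]])
    next
      fix x :: "('n, 'k) mpoly"
      assume *: "\<forall>w\<in>?W. \<exists>!i. i < length (map cell D) \<and> w \<in> map cell D ! i"
        and x: "Poly_Mapping.keys x \<subseteq> ?W"
      have "C \<subseteq> ?W" if "C \<in> set (map cell D)" for C
      proof -
        from that obtain m Z where C: "C = cell (m, Z)" "(m, Z) \<in> set D"
          by (metis imageE list.set_map surj_pair)
        with \<open>?G\<close> obtain u where "Poly_Mapping.keys m = {u}" "k \<le> total_degree u" by blast
        then show ?thesis by (auto simp: C(1))
      qed
      with *[rule_format] x show "\<exists>!vs :: ('n, 'k) mpoly list.
          list_all2 (\<lambda>v C. Poly_Mapping.keys v \<subseteq> C) vs (map cell D) \<and> x = sum_list vs"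
        by (intro direct_sum_if_partition[of ?W])
    qed
    also have "\<dots> \<longleftrightarrow> (\<forall>w. k \<le> total_degree w \<longrightarrow> (\<exists>!i. i < length D \<and> w \<in> cell (D ! i)))"
      by (simp cong: conj_cong)
    finally show ?thesis .
  qed
  then show ?thesis
    unfolding multigraded_module.stanley_decomposition_def[OF mgm] generators
    by (intro conj_cong refl)
qed

section \<open>Counting monomials\<close>

definition monomials :: "nat \<Rightarrow> ('n::finite \<Rightarrow>\<^sub>0 nat) set"
  where "monomials d = {u. total_degree u = d}"

text \<open>Every exponent is bounded by the total degree, so the exponent functions lie in a finite
  function space.\<close>

lemma finite_monomials: "finite (monomials d :: ('n::finite \<Rightarrow>\<^sub>0 nat) set)"
proof (rule finite_imageD)
  have "Poly_Mapping.lookup u i \<le> total_degree u" for u :: "'n \<Rightarrow>\<^sub>0 nat" and i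
    unfolding total_degree_def by (rule member_le_sum) auto
  then have "Poly_Mapping.lookup ` monomials d \<subseteq> (UNIV :: 'n set) \<rightarrow>\<^sub>E {..d}"
    by (auto simp: monomials_def)
  then show "finite (Poly_Mapping.lookup ` (monomials d :: ('n \<Rightarrow>\<^sub>0 nat) set))"
    by (rule finite_subset) (simp add: finite_PiE)
  show "inj_on Poly_Mapping.lookup (monomials d :: ('n \<Rightarrow>\<^sub>0 nat) set)"
    by (simp add: inj_on_def poly_mapping.lookup_inject)
qed

lemma monomials_nonempty: "monomials d \<noteq> ({} :: ('n::finite \<Rightarrow>\<^sub>0 nat) set)"
proof -
  have "Poly_Mapping.single (undefined :: 'n) d \<in> monomials d" by (simp add: monomials_def)
  then show ?thesis by blast
qed

text \<open>Both sides count the pairs of a monomial \<open>v\<close> of degree \<open>k + 1\<close> and a variable \<open>x\<^sub>i\<close> dividing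
  it, weighted by the exponent of \<open>x\<^sub>i\<close> in \<open>v\<close>: the left one via the quotient \<open>v / x\<^sub>i\<close>.\<close>

lemma card_monomials_Suc:
  "(CARD('n) + k) * card (monomials k :: ('n::finite \<Rightarrow>\<^sub>0 nat) set)
    = Suc k * card (monomials (Suc k) :: ('n \<Rightarrow>\<^sub>0 nat) set)"
proof -
  let ?A = "monomials k :: ('n \<Rightarrow>\<^sub>0 nat) set" and ?B = "monomials (Suc k) :: ('n \<Rightarrow>\<^sub>0 nat) set"
  let ?e = "\<lambda>i :: 'n. Poly_Mapping.single i (Suc 0)"
  have minus_add: "v - ?e i + ?e i = v" if "i \<in> Poly_Mapping.keys v" for v i
    using that by (metis in_keys_imp_split add_diff_cancel_right' One_nat_def)
  have deg: "total_degree (v - ?e i) = k" if "i \<in> Poly_Mapping.keys v" "total_degree v = Suc k" for v i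
    using total_degree_add[of "v - ?e i" "?e i"] unfolding minus_add[OF that(1)] that(2) by simp
  have key: "i \<in> Poly_Mapping.keys (u + ?e i)" for u i
    by (simp add: in_keys_iff lookup_add)
  have exponent: "Suc (Poly_Mapping.lookup (v - ?e i) i) = Poly_Mapping.lookup v i"
    if "i \<in> Poly_Mapping.keys v" for v i
    using that by (simp add: in_keys_iff lookup_minus)
  have "Suc k * card ?B = (\<Sum>v\<in>?B. \<Sum>i\<in>UNIV. Poly_Mapping.lookup v i)"
    by (simp add: monomials_def total_degree_def)
  also have "\<dots> = (\<Sum>(v, i)\<in>?B \<times> UNIV. Poly_Mapping.lookup v i)"
    by (rule sum.cartesian_product)
  \<comment> \<open>Pairs with exponent 0 contribute nothing. Dropping them leaves those where
    subtracting \<open>?e i\<close> is not truncated and hence is division by the variable.\<close>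
  also have "\<dots> = (\<Sum>(v, i)\<in>Sigma ?B Poly_Mapping.keys. Poly_Mapping.lookup v i)"
    by (rule sum.mono_neutral_right) (auto simp: finite_monomials in_keys_iff)
  also have "\<dots> = (\<Sum>(u, i)\<in>?A \<times> UNIV. Poly_Mapping.lookup u i + 1)"
    by (rule sum.reindex_bij_witness[of _ "\<lambda>(u, i). (u + ?e i, i)" "\<lambda>(v, i). (v - ?e i, i)"])
      (auto simp: minus_add deg key exponent monomials_def)
  also have "\<dots> = (\<Sum>u\<in>?A. \<Sum>i\<in>UNIV. Poly_Mapping.lookup u i + 1)"
    by (rule sum.cartesian_product[symmetric])
  also have "\<dots> = (\<Sum>u\<in>?A. k + CARD('n))"
    by (rule sum.cong) (auto simp: sum_Suc monomials_def total_degree_def)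
  finally show ?thesis by (simp add: algebra_simps)
qed

section \<open>The growth inequality forced by a decomposition\<close>

lemma card_monomials_le_if_decomposition:
  fixes D :: "(('n::finite, 'k::field) mpoly \<times> 'n set) list"
  assumes D: "stanley_decomposition_power k D" and d: "\<And>m Z. (m, Z) \<in> set D \<Longrightarrow> d \<le> card Z"
  shows "d * card (monomials k :: ('n \<Rightarrow>\<^sub>0 nat) set) \<le> card (monomials (Suc k) :: ('n \<Rightarrow>\<^sub>0 nat) set)"
proof -
  let ?A = "monomials k :: ('n \<Rightarrow>\<^sub>0 nat) set"
  let ?e = "\<lambda>i :: 'n. Poly_Mapping.single i (1 :: nat)"
  have gen: "\<And>m Z. (m, Z) \<in> set D \<Longrightarrow> \<exists>u. Poly_Mapping.keys m = {u} \<and> k \<le> total_degree u"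
    and part: "\<And>w. k \<le> total_degree w \<Longrightarrow> \<exists>!i. i < length D \<and> w \<in> cell (D ! i)"
    using D unfolding stanley_decomposition_power_iff by blast+
  \<comment> \<open>The generator of the cell containing \<open>u\<close> divides \<open>u\<close>
    and has degree at least \<open>k\<close>, so the cofactor has degree 0.\<close>
  have "\<exists>i<length D. Poly_Mapping.keys (fst (D ! i)) = {u}" if u: "u \<in> ?A" for u
  proof -
    obtain i where i: "i < length D" "u \<in> cell (D ! i)"
      using part[of u] u by (auto simp: monomials_def)
    obtain m Z where mZ: "D ! i = (m, Z)" by (cases "D ! i")
    with gen i(1) obtain u' where u': "Poly_Mapping.keys m = {u'}" "k \<le> total_degree u'"
      by (metis nth_mem)
    with i(2) mZ obtain t where "u = t + u'" by auto
    moreover from this u have "total_degree t + total_degree u' = k" by (simp add: monomials_def)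
    with u'(2) have "total_degree t = 0" by linarith
    ultimately have "u = u'" by simp
    with u'(1) mZ i(1) show ?thesis by auto
  qed
  then obtain idx where idx: "\<And>u. u \<in> ?A \<Longrightarrow> idx u < length D"
    "\<And>u. u \<in> ?A \<Longrightarrow> Poly_Mapping.keys (fst (D ! idx u)) = {u}" by metis
  define Z where "Z u = snd (D ! idx u)" for u
  \<comment> \<open>Equal products lie in the cells of both \<open>u\<close> and \<open>u'\<close>.
    Disjointness identifies the indices, hence the monomials, and cancellation then identifies the
    variables.\<close>
  have "inj_on (\<lambda>(u, z). u + ?e z) (Sigma ?A Z)"
  proof (rule inj_onI, clarify)
    fix u z u' z'
    assume u: "u \<in> ?A" "z \<in> Z u" and u': "u' \<in> ?A" "z' \<in> Z u'" and eq: "u + ?e z = u' + ?e z'"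
    have in_cell: "v + ?e y \<in> cell (D ! idx v)" if "v \<in> ?A" "y \<in> Z v" for v y
    proof -
      have "D ! idx v = (fst (D ! idx v), Z v)" by (simp add: Z_def)
      moreover have "v + ?e y \<in> cell (fst (D ! idx v), Z v)"
        using idx(2)[OF that(1)] that(2)
        by (auto intro!: exI[of _ "?e y"] simp: add.commute)
      ultimately show ?thesis by simp
    qed
    have "k \<le> total_degree (u + ?e z)" using u(1) by (simp add: monomials_def)
    moreover have "u + ?e z \<in> cell (D ! idx u)" using in_cell u by blast
    moreover have "u + ?e z \<in> cell (D ! idx u')" using in_cell u' eq by metis
    ultimately have "idx u = idx u'" using part idx(1) u(1) u'(1) by blast
    then have "u = u'" using idx(2) u(1) u'(1) by (metis singleton_inject)
    with eq have "?e z = ?e z'" by simp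
    then have "z = z'" by (metis keys_single one_neq_zero singleton_inject)
    with \<open>u = u'\<close> show "u = u' \<and> z = z'" by simp
  qed
  moreover have "(\<lambda>(u, z). u + ?e z) ` Sigma ?A Z \<subseteq> monomials (Suc k)"
    by (auto simp: monomials_def)
  ultimately have "card (Sigma ?A Z) \<le> card (monomials (Suc k) :: ('n \<Rightarrow>\<^sub>0 nat) set)"
    by (metis card_image card_mono finite_monomials)
  moreover have "card (Sigma ?A Z) = (\<Sum>u\<in>?A. card (Z u))"
    by (simp add: finite_monomials)
  moreover have "d \<le> card (Z u)" if "u \<in> ?A" for u
    using d[of "fst (D ! idx u)" "Z u"] idx(1)[OF that] by (simp add: Z_def)
  then have "d * card ?A \<le> (\<Sum>u\<in>?A. card (Z u))"
    using sum_bounded_below[of ?A d "\<lambda>u. card (Z u)"] by (simp add: mult.commute)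
  ultimately show ?thesis by simp
qed

section \<open>A decomposition without zero-dimensional spaces\<close>

text \<open>Below, \<open>f\<close> is an injective numbering, that is, an ordering of the
  variables. The condition on all keys, rather than on their maximum, gives every variable for
  \<open>u = 0\<close>.\<close>

definition tail :: "('n \<Rightarrow> nat) \<Rightarrow> ('n \<Rightarrow>\<^sub>0 nat) \<Rightarrow> 'n set"
  where "tail f u = {j. \<forall>i\<in>Poly_Mapping.keys u. f i \<le> f j}"

lemma obtain_last_key:
  fixes u :: "'n \<Rightarrow>\<^sub>0 nat" and f :: "'n \<Rightarrow> nat"
  assumes "u \<noteq> 0"
  obtains j where "j \<in> Poly_Mapping.keys u" and "j \<in> tail f u"
proof -
  have "Max (f ` Poly_Mapping.keys u) \<in> f ` Poly_Mapping.keys u"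
    using assms by (intro Max_in) auto
  then obtain j where "j \<in> Poly_Mapping.keys u" "f j = Max (f ` Poly_Mapping.keys u)" by auto
  then show thesis by (intro that[of j]) (simp_all add: tail_def)
qed

lemma card_tail_pos: "1 \<le> card (tail f (u :: 'n::finite \<Rightarrow>\<^sub>0 nat))"
proof -
  have "tail f u \<noteq> {}"
  proof (cases "u = 0")
    case True
    then show ?thesis by (simp add: tail_def)
  next
    case False
    then show ?thesis using obtain_last_key[of u f] by blast
  qed
  then show ?thesis by (simp add: Suc_le_eq card_gt_0_iff)
qed

text \<open>Strip the last variable from \<open>w\<close> repeatedly until degree \<open>k\<close>
  is left; the stripped variables make up \<open>t\<close>.\<close>

lemma tail_factor_exists:
  fixes w :: "'n::finite \<Rightarrow>\<^sub>0 nat"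
  assumes "k \<le> total_degree w"
  shows "\<exists>t u. w = t + u \<and> total_degree u = k \<and> Poly_Mapping.keys t \<subseteq> tail f u"
  using assms
proof (induction "total_degree w" arbitrary: w rule: less_induct)
  case less
  show ?case
  proof (cases "total_degree w = k")
    case True
    then show ?thesis by (intro exI[of _ 0] exI[of _ w]) simp
  next
    case False
    with less.prems have "w \<noteq> 0" by auto
    then obtain j where j: "j \<in> Poly_Mapping.keys w" "j \<in> tail f w"
      using obtain_last_key by blast
    from j(1) obtain v where w: "w = v + Poly_Mapping.single j 1" by (rule in_keys_imp_split)
    with less.prems False have "total_degree v < total_degree w" "k \<le> total_degree v" by auto
    from less.hyps[OF this] obtain t u
      where tu: "v = t + u" "total_degree u = k" "Poly_Mapping.keys t \<subseteq> tail f u" by blast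
    \<comment> \<open>A variable not before any variable of \<open>w\<close> is not before any
      variable of its divisor \<open>u\<close>.\<close>
    have "Poly_Mapping.keys u \<subseteq> Poly_Mapping.keys w"
      by (auto simp: w tu(1) in_keys_iff lookup_add)
    with j(2) have "j \<in> tail f u" by (auto simp: tail_def)
    with tu(3) keys_add[of t "Poly_Mapping.single j 1"]
    have "Poly_Mapping.keys (t + Poly_Mapping.single j 1) \<subseteq> tail f u" by auto
    moreover have "w = (t + Poly_Mapping.single j 1) + u" by (simp add: w tu(1) ac_simps)
    ultimately show ?thesis using tu(2) by blast
  qed
qed

text \<open>Otherwise \<open>v\<close> would be pointwise at most \<open>u\<close> with the same
  exponent sum, hence equal to \<open>u\<close>.\<close>

lemma exists_smaller_exponent:
  fixes u v :: "'n::finite \<Rightarrow>\<^sub>0 nat"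
  assumes "total_degree u = total_degree v" and "u \<noteq> v"
  obtains i where "Poly_Mapping.lookup u i < Poly_Mapping.lookup v i"
proof -
  have "\<exists>i. Poly_Mapping.lookup u i < Poly_Mapping.lookup v i"
  proof (rule ccontr)
    assume "\<nexists>i. Poly_Mapping.lookup u i < Poly_Mapping.lookup v i"
    then have "Poly_Mapping.lookup v i = Poly_Mapping.lookup u i" for i
      using assms(1) unfolding total_degree_def
      by (intro sum_mono_inv[of "Poly_Mapping.lookup v" UNIV "Poly_Mapping.lookup u" i])
        (auto simp: not_less)
    with assms(2) show False by (metis poly_mapping_eqI)
  qed
  then show thesis using that by blast
qed

text \<open>If the factors differ, some \<open>x\<^sub>i\<close> has a larger exponent in \<open>u'\<close> and some \<open>x\<^sub>j\<close> in \<open>u\<close>; then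
  \<open>x\<^sub>i\<close> divides \<open>t\<close> and \<open>x\<^sub>j\<close> divides \<open>t'\<close>, so each of \<open>i\<close> and \<open>j\<close> is at most the other.\<close>

lemma tail_factor_unique:
  fixes t u t' u' :: "'n::finite \<Rightarrow>\<^sub>0 nat"
  assumes "inj f" and "t + u = t' + u'" and "total_degree u = total_degree u'"
    and "Poly_Mapping.keys t \<subseteq> tail f u" and "Poly_Mapping.keys t' \<subseteq> tail f u'"
  shows "u = u'"
proof (rule ccontr)
  assume "u \<noteq> u'"
  with assms(3) obtain i j where i: "Poly_Mapping.lookup u i < Poly_Mapping.lookup u' i"
    and j: "Poly_Mapping.lookup u' j < Poly_Mapping.lookup u j"
    by (metis exists_smaller_exponent)
  have eq: "Poly_Mapping.lookup t l + Poly_Mapping.lookup u l =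
      Poly_Mapping.lookup t' l + Poly_Mapping.lookup u' l" for l
    using assms(2) by (metis lookup_add)
  have "i \<in> Poly_Mapping.keys t" "j \<in> Poly_Mapping.keys t'"
    using i j eq[of i] eq[of j] by (auto simp: in_keys_iff)
  moreover have "i \<in> Poly_Mapping.keys u'" "j \<in> Poly_Mapping.keys u"
    using i j by (auto simp: in_keys_iff)
  ultimately have "f i = f j"
    using assms(4,5) by (intro antisym) (auto simp: tail_def)
  with \<open>inj f\<close> have "i = j" by (rule injD)
  with i j show False by simp
qed

text \<open>Existence and uniqueness of the tail factorization say exactly that the Eliahou-Kervaire
  cells of the monomials of degree \<open>k\<close> form a partition.\<close>

lemma decomposition_of_positive_dimension:
  obtains D :: "(('n::finite, 'k::field) mpoly \<times> 'n set) list"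
  where "stanley_decomposition_power k D" and "\<And>m Z. (m, Z) \<in> set D \<Longrightarrow> 1 \<le> card Z"
proof -
  obtain f :: "'n \<Rightarrow> nat" where f: "inj f"
    using finite_imp_inj_to_nat_seg[OF finite[of "UNIV :: 'n set"]] by blast
  \<comment> \<open>Distinctness matters because decompositions are lists: a repeated generator
    would make the index of its cell ambiguous.\<close>
  obtain us :: "('n \<Rightarrow>\<^sub>0 nat) list" where us: "set us = monomials k" "distinct us"
    using finite_distinct_list[OF finite_monomials] by blast
  define D where "D = map (\<lambda>u. (Poly_Mapping.single u 1 :: ('n, 'k) mpoly, tail f u)) us"
  have cell: "w \<in> cell (D ! i) \<longleftrightarrow> (\<exists>t. Poly_Mapping.keys t \<subseteq> tail f (us ! i) \<and> w = t + us ! i)"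
    if "i < length us" for w i
    using that by (auto simp: D_def)
  have len: "length D = length us" by (simp add: D_def)
  have "\<exists>!i. i < length D \<and> w \<in> cell (D ! i)" if w: "k \<le> total_degree w" for w
  proof -
    obtain t u where tu: "w = t + u" "total_degree u = k" "Poly_Mapping.keys t \<subseteq> tail f u"
      using tail_factor_exists[OF w] by blast
    then have "u \<in> set us" by (simp add: us(1) monomials_def)
    then obtain i where i: "i < length us" "us ! i = u" by (auto simp: in_set_conv_nth)
    show ?thesis
    proof
      show "i < length D \<and> w \<in> cell (D ! i)"
        using i tu cell[OF i(1)] by (auto simp: len)
    next
      fix j assume "j < length D \<and> w \<in> cell (D ! j)"
      then have j: "j < length us" "w \<in> cell (D ! j)" by (simp_all add: len)
      then obtain t' where t': "Poly_Mapping.keys t' \<subseteq> tail f (us ! j)" "w = t' + us ! j"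
        using cell by blast
      have "us ! j \<in> monomials k" using j(1) us(1) nth_mem by blast
      then have "us ! j = u"
        using tail_factor_unique[OF f, of t' "us ! j" t u] t' tu by (simp add: monomials_def)
      then show "j = i" using i j(1) us(2) by (metis nth_eq_iff_index_eq)
    qed
  qed
  moreover have "\<forall>(m, Z)\<in>set D. \<exists>u. Poly_Mapping.keys m = {u} \<and> k \<le> total_degree u"
    using us(1) by (auto simp: D_def monomials_def)
  ultimately have "stanley_decomposition_power k D"
    by (simp only: stanley_decomposition_power_iff) blast
  moreover have "1 \<le> card Z" if "(m, Z) \<in> set D" for m Z
    using that card_tail_pos[of f] by (auto simp: D_def)
  ultimately show thesis by (rule that)
qed

section \<open>Bounds on the Stanley depth\<close>

lemma ideal_sdepth_max_ideal_power_bounds: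
  fixes k :: nat
  defines "s \<equiv> ideal_sdepth (ideal_power max_ideal k :: ('n::finite, 'k::field) mpoly set)"
  shows "1 \<le> s" and "Suc k * s \<le> CARD('n) + k"
proof -
  note mgm = multigraded_module_max_ideal_power[of k, where ?'n = 'n and ?'k = 'k]
  let ?depth = "\<lambda>D :: (('n, 'k) mpoly \<times> 'n set) list. Min ((\<lambda>(m, Z). card Z) ` set D)"
  let ?S = "{?depth D | D. stanley_decomposition_power k D}"
  have s: "s = Max ?S"
    by (simp add: s_def ideal_sdepth_def multigraded_module.sdepth_def[OF mgm]
        multigraded_module.decomposition_sdepth_def[OF mgm])
  \<comment> \<open>The monomial of degree \<open>k\<close> in one variable has to be covered, so
    the minimum over a decomposition is a genuine one.\<close>
  have nonempty: "set D \<noteq> {}" if "stanley_decomposition_power k D" for D :: "(('n, 'k) mpoly \<times> 'n set) list"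
  proof -
    have "k \<le> total_degree (Poly_Mapping.single (undefined :: 'n) k)" by simp
    with that have "\<exists>i. i < length D" unfolding stanley_decomposition_power_iff by blast
    then show ?thesis by auto
  qed
  have bound: "Suc k * d \<le> CARD('n) + k" if "d \<in> ?S" for d
  proof -
    let ?a = "card (monomials k :: ('n \<Rightarrow>\<^sub>0 nat) set)"
    from that obtain D :: "(('n, 'k) mpoly \<times> 'n set) list"
      where D: "stanley_decomposition_power k D" and d: "d = ?depth D" by blast
    have "d \<le> card Z" if "(m, Z) \<in> set D" for m Z
      unfolding d using that by (intro Min_le) force+
    with D have "d * ?a \<le> card (monomials (Suc k) :: ('n \<Rightarrow>\<^sub>0 nat) set)"
      by (rule card_monomials_le_if_decomposition)
    \<comment> \<open>The ratio of the two monomial counts turns the growth inequality into a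
      multiple of \<open>?a\<close> on both sides, and \<open>?a\<close> is positive and
      cancels.\<close>
    then have "Suc k * (d * ?a) \<le> (CARD('n) + k) * ?a"
      unfolding card_monomials_Suc by (rule mult_le_mono2)
    moreover have "0 < ?a" by (simp add: card_gt_0_iff finite_monomials monomials_nonempty)
    ultimately show ?thesis by (metis mult.assoc mult_le_cancel2)
  qed
  \<comment> \<open>The same bound makes the set of depths finite, so that \<open>Max\<close> is
    attained.\<close>
  have "?S \<subseteq> {..CARD('n) + k}"
  proof
    fix d assume "d \<in> ?S"
    then show "d \<in> {..CARD('n) + k}" using bound[of d] by simp
  qed
  then have finite: "finite ?S" by (rule finite_subset) simp
  obtain D :: "(('n, 'k) mpoly \<times> 'n set) list"
    where D: "stanley_decomposition_power k D" "\<And>m Z. (m, Z) \<in> set D \<Longrightarrow> 1 \<le> card Z"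
    using decomposition_of_positive_dimension by blast
  have "?depth D \<in> ?S" using D(1) by blast
  then have "?depth D \<le> s"
    unfolding s by (rule Max_ge[OF finite])
  moreover have "1 \<le> ?depth D"
    using nonempty[OF D(1)] D(2) by (subst Min_ge_iff) auto
  ultimately show "1 \<le> s" by linarith
  have "s \<in> ?S"
    unfolding s using finite \<open>?depth D \<in> ?S\<close> by (intro Max_in) (simp, metis empty_iff)
  then show "Suc k * s \<le> CARD('n) + k" by (rule bound)
qed

theorem theorem2p2:
  fixes k :: nat
  assumes "k \<ge> 1"
  shows "int (ideal_sdepth (ideal_power max_ideal k :: ('n::finite, 'k::field) mpoly set))
           \<le> \<lceil>real CARD('n) / real (k + 1)\<rceil> \<and>
         (k \<ge> CARD('n) - 1 \<longrightarrow>
           ideal_sdepth (ideal_power max_ideal k :: ('n, 'k) mpoly set) = 1)"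
proof -
  define s where "s = ideal_sdepth (ideal_power max_ideal k :: ('n, 'k) mpoly set)"
  have s: "1 \<le> s" "Suc k * s \<le> CARD('n) + k"
    unfolding s_def by (rule ideal_sdepth_max_ideal_power_bounds)+
  \<comment> \<open>Since \<open>n + k\<close> is one less than \<open>n + (k + 1)\<close>, the
    bound becomes strict; dividing by \<open>k + 1\<close> gives \<open>s - 1 < n / (k + 1)\<close>,
    which places the integer \<open>s\<close> below the ceiling.\<close>
  have "(k + 1) * s < CARD('n) + (k + 1)" using s(2) by simp
  then have "real (k + 1) * real s < real CARD('n) + real (k + 1)"
    by (metis of_nat_add of_nat_less_iff of_nat_mult)
  then have "real s - 1 < real CARD('n) / real (k + 1)"
    by (simp add: field_simps)
  then have "int s \<le> \<lceil>real CARD('n) / real (k + 1)\<rceil>" by linarith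
  moreover have "s = 1" if "k \<ge> CARD('n) - 1"
  proof (rule ccontr)
    assume "s \<noteq> 1"
    \<comment> \<open>A depth of at least 2 would give \<open>2 * (k + 1) \<le> n + k\<close>, that
      is, \<open>k + 2 \<le> n\<close>.\<close>
    then have "Suc k * 2 \<le> Suc k * s" using s(1) by (intro mult_le_mono2) simp
    with s(2) that show False by simp
  qed
  ultimately show ?thesis unfolding s_def by blast
qed

end
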